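(* Let $A_n$ be the alternating group of degree $n$. Then the power graph $P(A_n)$ is a firefly-type graph if and only if $n=4$.
   Context: The power graph $P(G)$ of a finite group $G$ is the simple graph with vertex set $G$ in which two distinct vertices $u,v$ are adjacent if and only if $u\in\langle v\rangle$ or $v\in\langle u\rangle$. For integers $1\le p\le m-1$, the firefly-type graph $F_{p,m-p}$ is $K_1\vee\left(pK_1\cup(m-p)K_2\right)$: a single vertex joined to all vertices of the disjoint union of $p$ copies of $K_1$ and $m-p$ copies of $K_2$. A graph is a firefly-type graph if it is isomorphic to $F_{p,m-p}$ for some integers $1\le p\le m-1$. *)

theory Defs
  imports
    "HOL-Algebra.Sym_Groups"
    "Graph_Theory.Pair_Digraph"
    "Graph_Theory.Digraph_Isomorphism"
begin

text \<open>
  A simple graph is a \<open>pair_graph\<close>: a finite, loop-free, symmetric set of arcs, so the edge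
  \<open>{u, v}\<close> is represented by the two arcs \<open>(u, v)\<close> and \<open>(v, u)\<close>.
\<close>

definition power_graph :: "('a, 'b) monoid_scheme \<Rightarrow> 'a pair_pre_digraph" where
  "power_graph G = \<lparr> pverts = carrier G,
     parcs = {(u, v). u \<in> carrier G \<and> v \<in> carrier G \<and> u \<noteq> v \<and>
                      (u \<in> generate G {v} \<or> v \<in> generate G {u})} \<rparr>"

definition complete_graph :: "nat \<Rightarrow> nat pair_pre_digraph" where
  "complete_graph n = \<lparr> pverts = {..<n}, parcs = {(u, v). u < n \<and> v < n \<and> u \<noteq> v} \<rparr>"

definition disjoint_union ::
    "'a pair_pre_digraph \<Rightarrow> 'b pair_pre_digraph \<Rightarrow> ('a + 'b) pair_pre_digraph" where
  "disjoint_union G H = \<lparr> pverts = pverts G <+> pverts H,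
     parcs = {(Inl u, Inl v) | u v. (u, v) \<in> parcs G}
       \<union> {(Inr u, Inr v) | u v. (u, v) \<in> parcs H} \<rparr>"

definition graph_join ::
    "'a pair_pre_digraph \<Rightarrow> 'b pair_pre_digraph \<Rightarrow> ('a + 'b) pair_pre_digraph" where
  "graph_join G H = \<lparr> pverts = pverts G <+> pverts H,
     parcs = parcs (disjoint_union G H)
       \<union> (Inl ` pverts G) \<times> (Inr ` pverts H)
       \<union> (Inr ` pverts H) \<times> (Inl ` pverts G) \<rparr>"

definition graph_copies :: "nat \<Rightarrow> 'a pair_pre_digraph \<Rightarrow> (nat \<times> 'a) pair_pre_digraph" where
  "graph_copies k G = \<lparr> pverts = {..<k} \<times> pverts G,
     parcs = {((i, u), (i, v)) | i u v. i < k \<and> (u, v) \<in> parcs G} \<rparr>"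

text \<open>
  \<open>firefly_graph p q\<close> is $F_{p,q} = K_1 \vee (p K_1 \cup q K_2)$.
\<close>

definition firefly_graph ::
    "nat \<Rightarrow> nat \<Rightarrow> (nat + (nat \<times> nat) + (nat \<times> nat)) pair_pre_digraph" where
  "firefly_graph p q = graph_join (complete_graph 1)
     (disjoint_union (graph_copies p (complete_graph 1)) (graph_copies q (complete_graph 2)))"

definition firefly_type_graph :: "'a pair_pre_digraph \<Rightarrow> bool" where
  "firefly_type_graph G \<longleftrightarrow>
     (\<exists>p m. 1 \<le> p \<and> p \<le> m - 1 \<and>
            digraph_iso (with_proj G) (with_proj (firefly_graph p (m - p))))"

lemma pair_graph_power_graph:
  assumes "finite (carrier G)"
  shows "pair_graph (power_graph G)"
proof -
  have "finite (parcs (power_graph G))"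
    by (rule finite_subset[of _ "carrier G \<times> carrier G"])
      (use assms in \<open>auto simp: power_graph_def\<close>)
  then show ?thesis
    using assms
    by unfold_locales (auto simp: power_graph_def symmetric_def sym_def)
qed

lemma pair_graph_firefly_graph: "pair_graph (firefly_graph p q)"
proof -
  let ?F = "firefly_graph p q"
  have wf: "parcs ?F \<subseteq> pverts ?F \<times> pverts ?F" and fin: "finite (pverts ?F)"
    by (auto simp: firefly_graph_def graph_join_def disjoint_union_def graph_copies_def
        complete_graph_def)
  then have "finite (parcs ?F)"
    by (meson finite_SigmaI finite_subset)
  moreover have "sym (parcs ?F)" and "\<And>e. e \<in> parcs ?F \<Longrightarrow> fst e \<noteq> snd e"
    by (auto simp: firefly_graph_def graph_join_def disjoint_union_def graph_copies_def
        complete_graph_def sym_def)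
  ultimately show ?thesis
    using wf fin by unfold_locales (auto simp: symmetric_def)
qed

end

theory Submission
  imports
    Defs
    "HOL-Algebra.Multiplicative_Group"
    "HOL-Computational_Algebra.Primes"
begin

text \<open>
  In a firefly graph every vertex other than the centre has at most one neighbour besides the
  centre. Hence a firefly graph contains no clique on four vertices. It has at least four vertices,
  since at least one copy each of \<open>K\<^sub>1\<close> and \<open>K\<^sub>2\<close> is joined to the centre.
  The bound on cliques rules out \<open>n \<ge> 5\<close>: a
  5-cycle generates a subgroup of prime order, any two elements of which are adjacent because
  each nontrivial element generates the whole subgroup.
  The bound on the number of vertices rules out \<open>n \<le> 3\<close>,
  where the alternating group has at most three elements.

  Conversely, if every nontrivial element \<open>x\<close> of a finite group has order 2 or 3, then
  \<open>\<langle>x\<rangle> = {1, x, x\<inverse>}\<close>, so two distinct nontrivial elements are adjacent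
  exactly when they are inverse to each other. The power graph is then the identity joined to the
  graph of the involution \<open>x \<mapsto> x\<inverse>\<close>: elements of order 2 are its isolated
  points and elements of order 3 come in adjacent pairs. Both orders occur in \<open>A\<^sub>4\<close>,
  and no others do, because each of its elements is a product of at most two transpositions.
  The lemmas \<open>firefly_type_graph_card_ge\<close>, \<open>firefly_type_graph_clique_card_le\<close>,
  \<open>clique_power_graph_generate\<close>, \<open>firefly_type_power_graph_if_ord\<close> and
  \<open>ord_image_alt_group_4\<close> carry this argument.
\<close>

section \<open>Isomorphism of simple graphs\<close>

text \<open>
  An isomorphism of digraphs has separate maps for vertices and arcs. Here an arc is
  the pair of its ends, so the arc map is determined by the vertex map.
\<close>

lemma digraph_iso_with_proj_iff:
  assumes "pair_graph G" and "pair_graph H"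
  shows "digraph_iso (with_proj G) (with_proj H) \<longleftrightarrow>
    (\<exists>f. bij_betw f (pverts G) (pverts H) \<and>
      (\<forall>u\<in>pverts G. \<forall>v\<in>pverts G. (u, v) \<in> parcs G \<longleftrightarrow> (f u, f v) \<in> parcs H))"
    (is "?iso \<longleftrightarrow> (\<exists>f. ?bij f)")
proof -
  interpret G: pair_graph G by fact
  interpret H: pair_graph H by fact
  have G: "pair_wf_digraph G" and H: "pair_wf_digraph H"
    by unfold_locales
  show ?thesis
  proof
    assume ?iso
    then obtain h where h: "pre_digraph.digraph_isomorphism (with_proj G) h"
      and eq: "with_proj H = app_iso h (with_proj G)"
      unfolding digraph_iso_def by blast
    from h have inj: "inj_on (iso_verts h) (pverts G)"
      and ends: "\<And>a. a \<in> parcs G \<Longrightarrow> iso_verts h (fst a) = iso_tail h (iso_arcs h a) \<and>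
        iso_verts h (snd a) = iso_head h (iso_arcs h a)"
      by (auto simp: pre_digraph.digraph_isomorphism_def)
    from eq have verts: "pverts H = iso_verts h ` pverts G"
      and arcs: "parcs H = iso_arcs h ` parcs G"
      and ht: "iso_tail h = fst" "iso_head h = snd"
      by (simp_all add: app_iso_def with_proj_def)
    have arc: "iso_arcs h (u, v) = (iso_verts h u, iso_verts h v)" if "(u, v) \<in> parcs G" for u v
      using ends[OF that] ht by (simp add: prod_eq_iff)
    have "(u, v) \<in> parcs G \<longleftrightarrow> (iso_verts h u, iso_verts h v) \<in> parcs H"
      if uv: "u \<in> pverts G" "v \<in> pverts G" for u v
    proof
      assume "(u, v) \<in> parcs G"
      then show "(iso_verts h u, iso_verts h v) \<in> parcs H"
        using arc arcs by force
    next
      assume "(iso_verts h u, iso_verts h v) \<in> parcs H"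
      then obtain u' v' where a: "(u', v') \<in> parcs G" "(iso_verts h u, iso_verts h v) = iso_arcs h (u', v')"
        using arcs by auto
      moreover have "u' \<in> pverts G" "v' \<in> pverts G"
        using pair_wf_digraph.wellformed'[OF G a(1)] by auto
      ultimately show "(u, v) \<in> parcs G"
        using arc[OF a(1)] uv inj by (auto dest: inj_onD)
    qed
    then have "?bij (iso_verts h)"
      using inj verts by (auto simp: bij_betw_def)
    then show "\<exists>f. ?bij f"
      by (rule exI[of _ "iso_verts h"])
  next
    assume "\<exists>f. ?bij f"
    then obtain f where f: "?bij f"
      by (elim exE)
    define h where "h = \<lparr>iso_verts = f, iso_arcs = map_prod f f, iso_head = snd, iso_tail = fst\<rparr>"
    have inj: "inj_on f (pverts G)" and img: "f ` pverts G = pverts H"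
      using f by (auto simp: bij_betw_def)
    have sub: "parcs G \<subseteq> pverts G \<times> pverts G"
      using pair_wf_digraph.wellformed'[OF G] by auto
    have "inj_on (map_prod f f) (parcs G)"
      using map_prod_inj_on[OF inj inj] sub by (rule inj_on_subset)
    then have "pre_digraph.digraph_isomorphism (with_proj G) h"
      using inj G.wf_digraph_axioms
      by (auto simp: pre_digraph.digraph_isomorphism_def h_def)
    moreover have "map_prod f f ` parcs G = parcs H"
    proof
      show "map_prod f f ` parcs G \<subseteq> parcs H"
        using f sub by fastforce
      show "parcs H \<subseteq> map_prod f f ` parcs G"
      proof clarify
        fix x y assume xy: "(x, y) \<in> parcs H"
        then obtain u v where "u \<in> pverts G" "v \<in> pverts G" "x = f u" "y = f v"
          using pair_wf_digraph.wellformed'[OF H xy] img by blast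
        then show "(x, y) \<in> map_prod f f ` parcs G"
          using f xy by force
      qed
    qed
    then have "with_proj H = app_iso h (with_proj G)"
      using img by (simp add: app_iso_def with_proj_def h_def)
    ultimately show ?iso
      unfolding digraph_iso_def by blast
  qed
qed

section \<open>Structure of firefly graphs\<close>

lemma pverts_firefly_graph:
  "pverts (firefly_graph p q) = insert (Inl 0)
     ((\<lambda>i. Inr (Inl (i, 0))) ` {..<p} \<union>
      ((\<lambda>j. Inr (Inr (j, 0))) ` {..<q} \<union> (\<lambda>j. Inr (Inr (j, 1))) ` {..<q}))"
proof -
  have *: "{..<1} = {0::nat}" "{..<2} = {0, 1::nat}"
    by auto
  show ?thesis
    unfolding firefly_graph_def graph_join_def disjoint_union_def graph_copies_def
      complete_graph_def Plus_def pair_pre_digraph.simps *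
    by blast
qed

lemma parcs_firefly_graph_simps:
  "(Inl a, Inl b) \<notin> parcs (firefly_graph p q)"
  "(Inl a, Inr x) \<in> parcs (firefly_graph p q) \<longleftrightarrow> a = 0 \<and> Inr x \<in> pverts (firefly_graph p q)"
  "(Inr x, Inl a) \<in> parcs (firefly_graph p q) \<longleftrightarrow> a = 0 \<and> Inr x \<in> pverts (firefly_graph p q)"
  "(Inr (Inl y), Inr x) \<notin> parcs (firefly_graph p q)"
  "(Inr x, Inr (Inl y)) \<notin> parcs (firefly_graph p q)"
  "(Inr (Inr (i, c)), Inr (Inr (j, d))) \<in> parcs (firefly_graph p q) \<longleftrightarrow>
    i = j \<and> i < q \<and> c < 2 \<and> d < 2 \<and> c \<noteq> d"
  by (auto simp: firefly_graph_def graph_join_def disjoint_union_def graph_copies_def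
      complete_graph_def)

lemma pverts_firefly_graph_iff:
  "Inl a \<in> pverts (firefly_graph p q) \<longleftrightarrow> a = 0"
  "Inr (Inl (i, a)) \<in> pverts (firefly_graph p q) \<longleftrightarrow> i < p \<and> a = 0"
  "Inr (Inr (j, a)) \<in> pverts (firefly_graph p q) \<longleftrightarrow> j < q \<and> a < 2"
  unfolding pverts_firefly_graph by (auto simp: less_2_cases_iff image_iff)

lemma parcs_firefly_graph_iff:
  assumes u: "u \<in> pverts (firefly_graph p q)" and v: "v \<in> pverts (firefly_graph p q)"
  shows "(u, v) \<in> parcs (firefly_graph p q) \<longleftrightarrow>
    u \<noteq> v \<and> (u = Inl 0 \<or> v = Inl 0 \<or> (\<exists>j a b. u = Inr (Inr (j, a)) \<and> v = Inr (Inr (j, b))))"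
proof -
  have cases: "w = Inl 0 \<or> (\<exists>i<p. w = Inr (Inl (i, 0))) \<or> (\<exists>j<q. \<exists>a<2. w = Inr (Inr (j, a)))"
    if "w \<in> pverts (firefly_graph p q)" for w
    using that unfolding pverts_firefly_graph by auto
  show ?thesis
  proof (cases "u = Inl 0 \<or> v = Inl 0")
    case True
    then show ?thesis
      using cases[OF u] cases[OF v]
      by (elim disjE exE conjE) (simp_all add: parcs_firefly_graph_simps pverts_firefly_graph_iff)
  next
    case False
    then show ?thesis
      using cases[OF u] cases[OF v]
      by (elim disjE exE conjE) (auto simp add: parcs_firefly_graph_simps pverts_firefly_graph_iff)
  qed
qed

lemma card_pverts_firefly_graph: "card (pverts (firefly_graph p q)) = 1 + p + 2 * q"
proof -
  let ?P = "(\<lambda>i. Inr (Inl (i, 0))) ` {..<p} :: (nat + (nat \<times> nat) + (nat \<times> nat)) set"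
  let ?Q = "\<lambda>a. (\<lambda>j. Inr (Inr (j, a))) ` {..<q} :: (nat + (nat \<times> nat) + (nat \<times> nat)) set"
  have "card ?P = p" and "card (?Q a) = q" for a
    by (simp_all add: card_image inj_on_def)
  moreover have "card (?P \<union> (?Q 0 \<union> ?Q 1)) = card ?P + card (?Q 0 \<union> ?Q 1)"
    by (rule card_Un_disjoint) auto
  moreover have "card (?Q 0 \<union> ?Q 1) = card (?Q 0) + card (?Q 1)"
    by (rule card_Un_disjoint) auto
  moreover have "card (pverts (firefly_graph p q)) = Suc (card (?P \<union> (?Q 0 \<union> ?Q 1)))"
    unfolding pverts_firefly_graph by (rule card_insert_disjoint) auto
  ultimately show ?thesis
    by simp
qed

definition clique :: "'a pair_pre_digraph \<Rightarrow> 'a set \<Rightarrow> bool" where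
  "clique G S \<longleftrightarrow> S \<subseteq> pverts G \<and> (\<forall>u\<in>S. \<forall>v\<in>S. u \<noteq> v \<longrightarrow> (u, v) \<in> parcs G)"

text \<open>
  Without the centre, a clique of two or more vertices lies in a single copy of \<open>K\<^sub>2\<close>.
\<close>

lemma clique_firefly_graph_card_le:
  assumes S: "clique (firefly_graph p q) S"
  shows "card S \<le> 3"
proof -
  have V: "S \<subseteq> pverts (firefly_graph p q)"
    using S by (simp add: clique_def)
  have adj: "\<exists>j a b. u = Inr (Inr (j, a)) \<and> v = Inr (Inr (j, b))"
    if "u \<in> S - {Inl 0}" "v \<in> S - {Inl 0}" "u \<noteq> v" for u v
  proof -
    have "(u, v) \<in> parcs (firefly_graph p q)"
      using S that by (auto simp: clique_def)
    then show ?thesis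
      using that V parcs_firefly_graph_iff[of u p q v] by auto
  qed
  have "card (S - {Inl 0}) \<le> 2"
  proof (cases "\<exists>u. S - {Inl 0} \<subseteq> {u}")
    case True
    then obtain u where "S - {Inl 0} \<subseteq> {u}" ..
    then show ?thesis
      using card_mono[of "{u}" "S - {Inl 0}"] by simp
  next
    case False
    then have ex: "\<exists>v\<in>S - {Inl 0}. v \<noteq> u" for u
      by blast
    then obtain u where u: "u \<in> S - {Inl 0}"
      by blast
    with ex[of u] adj obtain j a where j: "u = Inr (Inr (j, a))"
      by blast
    have "S - {Inl 0} \<subseteq> {Inr (Inr (j, 0)), Inr (Inr (j, 1))}"
    proof
      fix v assume v: "v \<in> S - {Inl 0}"
      have "\<exists>b. v = Inr (Inr (j, b))"
        using adj[OF u v] j by (cases "u = v") auto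
      then show "v \<in> {Inr (Inr (j, 0)), Inr (Inr (j, 1))}"
        using v V by (auto simp: pverts_firefly_graph)
    qed
    from card_mono[OF _ this] show ?thesis
      by simp
  qed
  moreover have "card S \<le> card (S - {Inl 0}) + 1"
    by (cases "finite S") (auto simp: card_Diff_singleton_if)
  ultimately show ?thesis
    by simp
qed

lemma firefly_type_graphE:
  assumes "pair_graph G" "firefly_type_graph G"
  obtains p q f where "1 \<le> p" "1 \<le> q" "bij_betw f (pverts G) (pverts (firefly_graph p q))"
    "\<forall>u\<in>pverts G. \<forall>v\<in>pverts G.
      (u, v) \<in> parcs G \<longleftrightarrow> (f u, f v) \<in> parcs (firefly_graph p q)"
proof -
  from assms(2) obtain p m where pm: "1 \<le> p" "p \<le> m - 1"
    and iso: "digraph_iso (with_proj G) (with_proj (firefly_graph p (m - p)))"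
    unfolding firefly_type_graph_def by blast
  from iso obtain f where "bij_betw f (pverts G) (pverts (firefly_graph p (m - p)))"
    "\<forall>u\<in>pverts G. \<forall>v\<in>pverts G.
      (u, v) \<in> parcs G \<longleftrightarrow> (f u, f v) \<in> parcs (firefly_graph p (m - p))"
    unfolding digraph_iso_with_proj_iff[OF assms(1) pair_graph_firefly_graph]
    by (elim exE conjE)
  then show thesis
    using pm by (intro that[of p "m - p" f]) simp_all
qed

lemma firefly_type_graph_card_ge:
  assumes "pair_graph G" "firefly_type_graph G"
  shows "4 \<le> card (pverts G)"
  using assms
proof (rule firefly_type_graphE)
  fix p q f
  assume pq: "1 \<le> p" "1 \<le> q" and f: "bij_betw f (pverts G) (pverts (firefly_graph p q))"
  show ?thesis
    using bij_betw_same_card[OF f] pq unfolding card_pverts_firefly_graph by simp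
qed

lemma firefly_type_graph_clique_card_le:
  assumes G: "pair_graph G" "firefly_type_graph G" and S: "clique G S"
  shows "card S \<le> 3"
proof -
  from G obtain p q f where "1 \<le> p" "1 \<le> q" and f: "bij_betw f (pverts G) (pverts (firefly_graph p q))"
    and adj: "\<forall>u\<in>pverts G. \<forall>v\<in>pverts G.
      (u, v) \<in> parcs G \<longleftrightarrow> (f u, f v) \<in> parcs (firefly_graph p q)"
    by (rule firefly_type_graphE)
  have sub: "S \<subseteq> pverts G"
    using S by (simp add: clique_def)
  have "(f u, f v) \<in> parcs (firefly_graph p q)" if "u \<in> S" "v \<in> S" "f u \<noteq> f v" for u v
  proof -
    have "(u, v) \<in> parcs G"
      using S that by (auto simp: clique_def)
    moreover have "u \<in> pverts G" "v \<in> pverts G"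
      using that sub by auto
    ultimately show ?thesis
      using adj by simp
  qed
  moreover have "f ` S \<subseteq> pverts (firefly_graph p q)"
    using f sub by (auto simp: bij_betw_def)
  ultimately have "clique (firefly_graph p q) (f ` S)"
    by (auto simp: clique_def)
  moreover have "card (f ` S) = card S"
    using f sub by (meson bij_betw_def card_image inj_on_subset)
  ultimately show ?thesis
    using clique_firefly_graph_card_le[of p q "f ` S"] by simp
qed

text \<open>
  The orbits of a fixed-point-free involution are pairs; choosing one element from each
  orbit splits the set into two halves that the involution exchanges.
\<close>

lemma involution_transversal:
  assumes "\<And>v. v \<in> N \<Longrightarrow> s v \<in> N" "\<And>v. v \<in> N \<Longrightarrow> s (s v) = v" "\<And>v. v \<in> N \<Longrightarrow> s v \<noteq> v"
  obtains R where "R \<union> s ` R = N" "R \<inter> s ` R = {}"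
proof -
  \<comment> \<open>The choice depends only on the orbit, so both of its elements get the same representative.\<close>
  define rep where "rep v = (SOME w. w \<in> {v, s v})" for v
  have rep: "rep v = v \<or> rep v = s v" for v
    using someI[of "\<lambda>w. w \<in> {v, s v}" v] by (auto simp: rep_def)
  have rep_s: "rep (s v) = rep v" if "v \<in> N" for v
    using assms(2)[OF that] by (simp add: rep_def insert_commute)
  define R where "R = {v \<in> N. rep v = v}"
  have "v \<in> R \<union> s ` R" if v: "v \<in> N" for v
  proof (cases "rep v = v")
    case True
    then show ?thesis using v by (simp add: R_def)
  next
    case False
    then have "s v \<in> R"
      using rep[of v] rep_s[OF v] assms(1)[OF v] by (simp add: R_def)
    then show ?thesis
      using assms(2)[OF v] by force
  qed
  moreover have "s v \<notin> R" if "v \<in> R" for v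
    using that rep_s[of v] assms(3)[of v] by (auto simp: R_def)
  ultimately show thesis
    using that[of R] assms(1) by (auto simp: R_def)
qed

text \<open>
  The fixed points of \<open>s\<close> become the copies of \<open>K\<^sub>1\<close> and its two-element orbits
  the copies of \<open>K\<^sub>2\<close>. The map is built from the firefly graph to \<open>G\<close>, where
  the vertices \<open>0\<close> and \<open>1\<close> of a \<open>K\<^sub>2\<close> go to a chosen orbit element
  and to its image.
\<close>

lemma firefly_type_graph_if_involution:
  fixes G :: "'a pair_pre_digraph"
  assumes G: "pair_graph G" and c: "c \<in> pverts G"
    and s: "\<And>v. v \<in> pverts G - {c} \<Longrightarrow> s v \<in> pverts G - {c}"
    and ss: "\<And>v. v \<in> pverts G - {c} \<Longrightarrow> s (s v) = v"
    and adj: "\<And>u v. u \<in> pverts G \<Longrightarrow> v \<in> pverts G \<Longrightarrow>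
      (u, v) \<in> parcs G \<longleftrightarrow> u \<noteq> v \<and> (u = c \<or> v = c \<or> v = s u)"
    and fixed: "\<exists>v\<in>pverts G - {c}. s v = v" and moved: "\<exists>v\<in>pverts G - {c}. s v \<noteq> v"
  shows "firefly_type_graph G"
proof -
  interpret G: pair_graph G by (rule G)
  define P where "P = {v \<in> pverts G - {c}. s v = v}"
  define N where "N = {v \<in> pverts G - {c}. s v \<noteq> v}"
  obtain R where R: "R \<union> s ` R = N" "R \<inter> s ` R = {}"
  proof (rule involution_transversal[of N s])
    fix v assume "v \<in> N"
    then have v: "v \<in> pverts G - {c}" "s v \<noteq> v"
      by (simp_all add: N_def)
    show "s (s v) = v" "s v \<noteq> v"
      using ss[OF v(1)] v(2) by simp_all
    then show "s v \<in> N"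
      using s[OF v(1)] by (simp add: N_def)
  qed
  have "P \<subseteq> pverts G" "R \<subseteq> pverts G"
    using R(1) by (auto simp: P_def N_def)
  then have fin: "finite P" "finite R"
    using G.pair_finite_verts finite_subset by blast+
  have RN: "r \<in> pverts G" "r \<noteq> c" "s r \<in> pverts G" "s r \<noteq> c" "s r \<noteq> r" "s (s r) = r" if "r \<in> R" for r
  proof -
    have "r \<in> N" "s r \<in> N"
      using that R(1) by blast+
    then show "r \<in> pverts G" "r \<noteq> c" "s r \<in> pverts G" "s r \<noteq> c" "s r \<noteq> r" "s (s r) = r"
      using ss[of r] by (simp_all add: N_def)
  qed
  define p q where "p = card P" and "q = card R"
  obtain e where e: "bij_betw e {..<p} P"
    using ex_bij_betw_nat_finite[OF fin(1)] unfolding p_def lessThan_atLeast0 by blast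
  obtain r where r: "bij_betw r {..<q} R"
    using ex_bij_betw_nat_finite[OF fin(2)] unfolding q_def lessThan_atLeast0 by blast
  have eP: "e i \<in> P" if "i < p" for i
    using e that by (auto simp: bij_betw_def)
  have rR: "r j \<in> R" if "j < q" for j
    using r that by (auto simp: bij_betw_def)
  have e_eq: "e i = e i' \<longleftrightarrow> i = i'" if "i < p" "i' < p" for i i'
    using e that by (auto simp: bij_betw_def dest: inj_onD)
  have r_eq: "r j = r j' \<longleftrightarrow> j = j'" if "j < q" "j' < q" for j j'
    using r that by (auto simp: bij_betw_def dest: inj_onD)
  have s_eq: "s (r j) = s (r j') \<longleftrightarrow> j = j'" if "j < q" "j' < q" for j j'
    using RN(6)[OF rR[OF that(1)]] RN(6)[OF rR[OF that(2)]] r_eq[OF that] by metis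
  have rs: "r j \<noteq> s (r j')" if "j < q" "j' < q" for j j'
    using R(2) rR that by blast
  have e_P: "e i \<in> pverts G" "e i \<noteq> c" "s (e i) = e i" if "i < p" for i
    using eP[OF that] by (auto simp: P_def)
  have r_R: "r j \<in> pverts G" "r j \<noteq> c" "s (r j) \<in> pverts G" "s (r j) \<noteq> c" "s (r j) \<noteq> r j"
    "s (s (r j)) = r j" if "j < q" for j
    using RN[OF rR[OF that]] by auto
  have er: "e i \<noteq> r j" "e i \<noteq> s (r j)" if "i < p" "j < q" for i j
    using e_P(3)[OF that(1)] r_R(5,6)[OF that(2)] by metis+
  note distinct_values = e_eq r_eq s_eq rs rs[symmetric] er er[symmetric]
    e_P(2) r_R(2,4,5) e_P(2)[symmetric] r_R(2,4,5)[symmetric]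
  define f :: "nat + (nat \<times> nat) + (nat \<times> nat) \<Rightarrow> 'a" where "f = case_sum (\<lambda>_. c) (case_sum (\<lambda>(i, _). e i)
    (\<lambda>(j, b). if b = 0 then r j else s (r j)))"
  have f_simps: "f (Inl a) = c" "f (Inr (Inl (i, a))) = e i" "f (Inr (Inr (j, 0))) = r j"
    "f (Inr (Inr (j, Suc 0))) = s (r j)" for a i j
    by (simp_all add: f_def)
  let ?F = "firefly_graph p q"
  have "inj_on f (pverts ?F)"
    unfolding pverts_firefly_graph
    by (rule inj_onI) (auto simp: f_simps distinct_values)
  moreover have "f ` pverts ?F = pverts G"
  proof -
    have "f ` pverts ?F = insert c (e ` {..<p} \<union> (r ` {..<q} \<union> s ` r ` {..<q}))"
      unfolding pverts_firefly_graph by (simp add: image_Un image_image f_simps)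
    also have "\<dots> = insert c (P \<union> N)"
      using e r R(1) by (simp add: bij_betw_def)
    also have "\<dots> = pverts G"
      using c by (auto simp: P_def N_def)
    finally show ?thesis .
  qed
  ultimately have bij: "bij_betw f (pverts ?F) (pverts G)"
    by (simp add: bij_betw_def)
  have "(u, v) \<in> parcs ?F \<longleftrightarrow> (f u, f v) \<in> parcs G"
    if uv: "u \<in> pverts ?F" "v \<in> pverts ?F" for u v
  proof -
    have ne: "u \<noteq> v \<longleftrightarrow> f u \<noteq> f v"
      using bij uv by (auto simp: bij_betw_def dest: inj_onD)
    have "(f u, f v) \<in> parcs G \<longleftrightarrow> f u \<noteq> f v \<and> (f u = c \<or> f v = c \<or> f v = s (f u))"
      using bij uv by (intro adj) (auto simp: bij_betw_def)
    moreover have "f u = c \<or> f v = c \<or> f v = s (f u) \<longleftrightarrow>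
        u = Inl 0 \<or> v = Inl 0 \<or> (\<exists>j a b. u = Inr (Inr (j, a)) \<and> v = Inr (Inr (j, b)))"
      if "u \<noteq> v"
      using that uv unfolding pverts_firefly_graph
      by (auto simp: f_simps distinct_values e_P(3) r_R(6))
    ultimately show ?thesis
      unfolding parcs_firefly_graph_iff[OF uv] using ne by blast
  qed
  with bij have "digraph_iso (with_proj ?F) (with_proj G)"
    unfolding digraph_iso_with_proj_iff[OF pair_graph_firefly_graph G] by blast
  moreover have "wf_digraph (with_proj ?F)"
  proof -
    interpret F: pair_graph ?F by (rule pair_graph_firefly_graph)
    show ?thesis by unfold_locales
  qed
  ultimately have "digraph_iso (with_proj G) (with_proj ?F)"
    by (rule digraph_iso_swap[rotated])
  moreover have "1 \<le> p"
    using fixed fin(1) by (auto simp: p_def P_def card_gt_0_iff Suc_le_eq)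
  moreover have "1 \<le> q"
  proof -
    have "N \<noteq> {}" using moved by (auto simp: N_def)
    then have "R \<noteq> {}" using R(1) by auto
    then show ?thesis using fin(2) by (simp add: q_def card_gt_0_iff Suc_le_eq)
  qed
  ultimately show ?thesis
    unfolding firefly_type_graph_def by (intro exI[of _ p] exI[of _ "p + q"]) auto
qed

section \<open>Power graphs of groups\<close>

context group
begin

text \<open>
  The order of \<open>u\<close> divides the prime order of \<open>x\<close> and is not 1, so both cyclic
  subgroups have the same size.
\<close>

lemma generate_eq_if_prime_ord:
  assumes x: "x \<in> carrier G" "prime (ord x)" and u: "u \<in> generate G {x}" "u \<noteq> \<one>"
  shows "generate G {u} = generate G {x}"
proof -
  have pos: "ord x > 0"
    using x(2) prime_gt_0_nat by blast
  obtain k :: nat where k: "u = x [^] k"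
    using u(1) generate_pow_nat[OF x(1)] pos by auto
  have uG: "u \<in> carrier G"
    using k x(1) by simp
  have "u [^] ord x = (x [^] ord x) [^] k"
    using x(1) by (simp add: k nat_pow_pow mult.commute del: pow_ord_eq_1)
  also have "\<dots> = \<one>"
    using x(1) by simp
  finally have "u [^] ord x = \<one>" .
  then have "ord u dvd ord x"
    using pow_eq_id[OF uG] by simp
  then have ord: "ord u = ord x"
    using x(2) u(2) ord_eq_1[OF uG] by (auto simp: prime_nat_iff)
  have "generate G {u} \<subseteq> generate G {x}"
    using x(1) u(1) by (intro generate_subgroup_incl generate_is_subgroup) auto
  moreover have "card (generate G {u}) = card (generate G {x})"
    using ord generate_pow_card[OF x(1)] generate_pow_card[OF uG] by simp
  moreover have "finite (generate G {x})"
    using pos generate_pow_card[OF x(1)] card_gt_0_iff by metis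
  ultimately show ?thesis
    using card_subset_eq by blast
qed

lemma clique_power_graph_generate:
  assumes x: "x \<in> carrier G" "prime (ord x)"
  shows "clique (power_graph G) (generate G {x})"
proof -
  have sub: "generate G {x} \<subseteq> carrier G"
    using x(1) by (intro generate_incl) auto
  have "u \<in> generate G {v} \<or> v \<in> generate G {u}"
    if uv: "u \<in> generate G {x}" "v \<in> generate G {x}" for u v
  proof (cases "u = \<one>")
    case True
    then show ?thesis
      by (simp add: generate.one)
  next
    case False
    then show ?thesis
      using generate_eq_if_prime_ord[OF x uv(1)] uv(2) by simp
  qed
  then show ?thesis
    using sub by (auto simp: clique_def power_graph_def)
qed

text \<open>
  In order 3 the square is the inverse, so no powers remain beyond \<open>1\<close>, \<open>x\<close>,
  \<open>x\<inverse>\<close>. This makes inversion the involution that governs the power graph.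
\<close>

lemma generate_subset_if_ord_2_or_3:
  assumes x: "x \<in> carrier G" and ord: "ord x = 2 \<or> ord x = 3"
  shows "generate G {x} \<subseteq> {\<one>, x, inv x}"
proof
  fix y assume "y \<in> generate G {x}"
  then obtain k where k: "y = x [^] k" "k \<le> ord x - 1"
    using generate_pow_nat[OF x] ord_elems_inf_carrier[OF x] ord by fastforce
  have "x [^] (2::nat) = inv x" if "ord x = 3"
  proof -
    have "x [^] (2::nat) \<otimes> x = \<one>"
      using pow_ord_eq_1[OF x] that by (simp add: numeral_3_eq_3 numeral_2_eq_2)
    then show ?thesis
      using x by (intro inv_equality[symmetric]) auto
  qed
  moreover have "k = 0 \<or> k = 1 \<or> k = 2 \<and> ord x = 3"
    using k(2) ord by auto
  ultimately show "y \<in> {\<one>, x, inv x}"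
    using x k(1) by auto
qed

lemma firefly_type_power_graph_if_ord:
  assumes fin: "finite (carrier G)" and ord: "ord ` (carrier G - {\<one>}) = {2, 3}"
  shows "firefly_type_graph (power_graph G)"
proof (rule firefly_type_graph_if_involution[of _ \<one> "\<lambda>x. inv x"])
  show "pair_graph (power_graph G)"
    using fin by (rule pair_graph_power_graph)
  have V: "pverts (power_graph G) = carrier G"
    by (simp add: power_graph_def)
  show "\<one> \<in> pverts (power_graph G)"
    by (simp add: V)
  show "inv x \<in> pverts (power_graph G) - {\<one>}" if "x \<in> pverts (power_graph G) - {\<one>}" for x
    using that by (auto simp: V inv_eq_1_iff)
  show "inv (inv x) = x" if "x \<in> pverts (power_graph G) - {\<one>}" for x
    using that by (simp add: V)
  have inv_in: "inv x \<in> generate G {x}" for x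
    by (simp add: generate.inv)
  have gen: "generate G {x} \<subseteq> {\<one>, x, inv x}" if "x \<in> carrier G" "x \<noteq> \<one>" for x
    using that ord by (intro generate_subset_if_ord_2_or_3) auto
  show "(u, v) \<in> parcs (power_graph G) \<longleftrightarrow> u \<noteq> v \<and> (u = \<one> \<or> v = \<one> \<or> v = inv u)"
    if "u \<in> pverts (power_graph G)" "v \<in> pverts (power_graph G)" for u v
  proof (cases "u = \<one> \<or> v = \<one>")
    case True
    then have "u \<in> generate G {v} \<or> v \<in> generate G {u}"
      using generate.one by blast
    then show ?thesis
      using that True by (auto simp: V power_graph_def)
  next
    case False
    then have uv: "u \<in> carrier G" "v \<in> carrier G" "u \<noteq> \<one>" "v \<noteq> \<one>"
      using that by (simp_all add: V)
    have "v = inv u" if "u \<noteq> v" "u \<in> generate G {v} \<or> v \<in> generate G {u}"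
      using that(2)
    proof
      assume "u \<in> generate G {v}"
      then have "u = inv v"
        using gen[of v] uv that(1) by auto
      then show ?thesis
        using uv by simp
    next
      assume "v \<in> generate G {u}"
      then show ?thesis
        using gen[of u] uv that(1) by auto
    qed
    then show ?thesis
      using uv inv_in[of u] by (auto simp: power_graph_def)
  qed
  from ord obtain a where "a \<in> carrier G - {\<one>}" "ord a = 2"
    by (metis imageE insertI1)
  then show "\<exists>x\<in>pverts (power_graph G) - {\<one>}. inv x = x"
    using pow_ord_eq_1[of a]
    by (intro bexI[of _ a]) (auto simp: V numeral_2_eq_2 intro: inv_equality)
  from ord obtain b where b: "b \<in> carrier G - {\<one>}" "ord b = 3"
    by (metis imageE insertI1 insertI2)
  have "inv b \<noteq> b"
  proof
    assume "inv b = b"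
    then have "b [^] (2::nat) = \<one>"
      using b(1) r_inv[of b] by (simp add: numeral_2_eq_2)
    then show False
      using pow_eq_id[of b 2] b by simp
  qed
  then show "\<exists>x\<in>pverts (power_graph G) - {\<one>}. inv x \<noteq> x"
    using b(1) by (auto simp: V)
qed

end

section \<open>Elements of alternating groups\<close>

lemma alt_group_pow: "p [^]\<^bsub>alt_group n\<^esub> (k::nat) = p ^^ k"
proof -
  interpret group "alt_group n"
    by (rule alt_group_is_group)
  show ?thesis
    by (induction k) (simp_all add: alt_group_one alt_group_mult funpow_Suc_right del: funpow.simps(2))
qed

lemma finite_alt_group: "finite (carrier (alt_group n))"
  by (rule finite_subset[OF _ finite_permutations[of "{1..n}"]]) (auto simp: alt_group_carrier)

lemma card_alt_group_le_3:
  assumes "n \<le> 3"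
  shows "card (carrier (alt_group n)) \<le> 3"
proof (cases "n \<ge> 2")
  case True
  have "(fact n :: nat) \<le> fact 3"
    using assms by (rule fact_mono)
  then show ?thesis
    using alt_group_card_carrier[OF True] by (simp add: fact_numeral)
next
  case False
  have "card (carrier (alt_group n)) \<le> card (carrier (sym_group n))"
    by (rule card_mono)
      (auto simp: alt_group_carrier sym_group_carrier sym_group_def finite_permutations)
  also have "\<dots> \<le> fact 1"
    unfolding sym_group_card_carrier using False by (intro fact_mono) simp
  finally show ?thesis
    by simp
qed

lemma ord_eq_5_in_alt_group:
  assumes "5 \<le> n"
  obtains s where "s \<in> carrier (alt_group n)" "group.ord (alt_group n) s = 5"
proof -
  interpret group "alt_group n"
    by (rule alt_group_is_group)
  define cs :: "nat list" where "cs = [1, 2, 3, 4, 5]"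
  define s where "s = cycle_of_list cs"
  have dist: "cycle cs" and len: "length cs = 5"
    by (simp_all add: cs_def)
  have "swapidseq 4 s"
    using swapidseq_ext_imp_swapidseq[OF swapidseq_ext_of_cycles[OF dist]] by (simp add: s_def len)
  then have "evenperm s"
    by (simp add: evenperm_unique)
  moreover have "s permutes {1..n}"
    unfolding s_def using assms
    by (intro permutes_subset[OF cycle_permutes]) (auto simp: cs_def)
  ultimately have s: "s \<in> carrier (alt_group n)"
    by (simp add: alt_group_carrier)
  have "s [^]\<^bsub>alt_group n\<^esub> (5::nat) = \<one>\<^bsub>alt_group n\<^esub>"
    using cycle_is_id_root[OF dist] by (simp add: alt_group_pow alt_group_one s_def len)
  then have "ord s dvd 5"
    using pow_eq_id[OF s] by simp
  moreover have "s 1 \<noteq> 1"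
    by (simp add: s_def cs_def)
  then have "ord s \<noteq> 1"
    using ord_eq_1[OF s] by (auto simp: alt_group_one)
  moreover have "prime (5::nat)"
    by simp
  ultimately have "ord s = 5"
    by (metis prime_nat_iff)
  with s show thesis
    by (rule that)
qed

text \<open>
  Two transpositions commute if they have the same or disjoint supports, or if one of them is
  trivial; their product is then an involution. Otherwise the supports share one point and the
  product is a 3-cycle.
\<close>

lemma transpose_transpose_pow_2_or_3:
  "(transpose a b \<circ> transpose c d) ^^ 2 = id \<or> (transpose a b \<circ> transpose c d) ^^ 3 = id"
proof (cases "a = b \<or> c = d \<or> {a, b} = {c, d} \<or> {a, b} \<inter> {c, d} = {}")
  case True
  then have "transpose a b \<circ> transpose c d = transpose c d \<circ> transpose a b"
    by (auto simp: transpose_def fun_eq_iff)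
  then have "(transpose a b \<circ> transpose c d) ^^ 2 = id"
    by (simp add: numeral_2_eq_2 fun_eq_iff)
  then show ?thesis ..
next
  case False
  then have "(transpose a b \<circ> transpose c d) ^^ 3 = id"
    by (auto simp: numeral_3_eq_3 fun_eq_iff transpose_def)
  then show ?thesis ..
qed

text \<open>
  Moving the points 4, 3, 2 into place one after the other writes a permutation of four points
  as a product of three transpositions, some of which may be trivial. Evenness forces one of
  them to be trivial.
\<close>

lemma alt_group_4_eq_transpose_transpose:
  assumes "x \<in> carrier (alt_group 4)"
  obtains a b c d where "x = transpose a b \<circ> transpose c d"
proof -
  have S: "{1..4} = {4, 3, 2, 1::nat}"
    by auto
  have step: "\<exists>b q. q permutes S \<and> p = transpose a b \<circ> q" if "p permutes insert a S"
    for p a and S :: "nat set"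
    using permutes_insert_lemma[OF that]
    by (intro exI[of _ "p a"] exI[of _ "transpose a (p a) \<circ> p"]) (simp add: fun_eq_iff)
  have "x permutes {4, 3, 2, 1}"
    using assms unfolding alt_group_carrier S by (rule conjunct1)
  then obtain b1 q1 where q1: "q1 permutes {3, 2, 1}" "x = transpose 4 b1 \<circ> q1"
    using step by blast
  then obtain b2 q2 where q2: "q2 permutes {2, 1}" "q1 = transpose 3 b2 \<circ> q2"
    using step by blast
  then obtain b3 q3 where q3: "q3 permutes {1}" "q2 = transpose 2 b3 \<circ> q3"
    using step by blast
  have x: "x = transpose 4 b1 \<circ> (transpose 3 b2 \<circ> transpose 2 b3)"
    using q1(2) q2(2) q3 by simp
  have "sign x = 1"
    using assms by (simp add: alt_group_carrier sign_def)
  \<comment> \<open>Three nontrivial transpositions would give sign \<open>-1\<close>.\<close>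
  then have "b1 = 4 \<or> b2 = 3 \<or> b3 = 2"
    unfolding x by (auto simp: sign_compose sign_swap_id permutation_compose permutation_swap_id
        split: if_splits)
  then show thesis
    using that x by auto
qed

lemma ord_image_alt_group_4:
  "group.ord (alt_group 4) ` (carrier (alt_group 4) - {\<one>\<^bsub>alt_group 4\<^esub>}) = {2, 3}"
proof -
  interpret group "alt_group 4"
    by (rule alt_group_is_group)
  have ord_eq: "ord x = p" if "x \<in> carrier (alt_group 4)" "x \<noteq> id" "x ^^ p = id" "prime p" for x p
  proof -
    have "ord x dvd p" "ord x \<noteq> 1"
      using that pow_eq_id[of x p] ord_eq_1[of x] by (simp_all add: alt_group_pow alt_group_one)
    then show ?thesis
      using that(4) by (auto simp: prime_nat_iff)
  qed
  have even: "transpose a b \<circ> transpose c d \<in> carrier (alt_group 4)"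
    if "a \<noteq> b" "c \<noteq> d" "{a, b, c, d} \<subseteq> {1..4}" for a b c d
    using that by (auto simp: alt_group_carrier evenperm_comp evenperm_swap permutation_swap_id
        intro!: permutes_compose permutes_swap_id)
  show ?thesis
  proof
    show "ord ` (carrier (alt_group 4) - {\<one>\<^bsub>alt_group 4\<^esub>}) \<subseteq> {2, 3}"
    proof (rule image_subsetI)
      fix x assume "x \<in> carrier (alt_group 4) - {\<one>\<^bsub>alt_group 4\<^esub>}"
      then have x: "x \<in> carrier (alt_group 4)" "x \<noteq> id"
        by (simp_all add: alt_group_one)
      have "x ^^ 2 = id \<or> x ^^ 3 = id"
        using alt_group_4_eq_transpose_transpose[OF x(1)] transpose_transpose_pow_2_or_3 by metis
      then show "ord x \<in> {2, 3}"
        using ord_eq[OF x, of 2] ord_eq[OF x, of 3] by auto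
    qed
    define x y :: "nat \<Rightarrow> nat"
      where "x = transpose 1 2 \<circ> transpose 3 4" and "y = transpose 1 2 \<circ> transpose 2 3"
    have mem: "x \<in> carrier (alt_group 4)" "y \<in> carrier (alt_group 4)"
      unfolding x_def y_def by (rule even; simp)+
    have "x 1 \<noteq> 1" "y 1 \<noteq> 1"
      by (simp_all add: x_def y_def transpose_def)
    then have ne: "x \<noteq> id" "y \<noteq> id"
      by auto
    have "x ^^ 2 = id"
      by (auto simp: x_def fun_eq_iff transpose_def numeral_2_eq_2)
    then have "ord x = 2"
      using ord_eq[OF mem(1) ne(1)] by simp
    moreover have "y ^^ 3 = id"
      by (auto simp: y_def fun_eq_iff transpose_def numeral_3_eq_3)
    then have "ord y = 3"
      using ord_eq[OF mem(2) ne(2)] by simp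
    moreover have "x \<in> carrier (alt_group 4) - {\<one>\<^bsub>alt_group 4\<^esub>}"
      "y \<in> carrier (alt_group 4) - {\<one>\<^bsub>alt_group 4\<^esub>}"
      using mem ne by (simp_all add: alt_group_one)
    ultimately show "{2, 3} \<subseteq> ord ` (carrier (alt_group 4) - {\<one>\<^bsub>alt_group 4\<^esub>})"
      by (metis empty_subsetI imageI insert_subset)
  qed
qed

theorem corollary3p3:
  fixes n :: nat
  shows "firefly_type_graph (power_graph (alt_group n)) \<longleftrightarrow> n = 4"
proof
  interpret group "alt_group n"
    by (rule alt_group_is_group)
  have graph: "pair_graph (power_graph (alt_group n))"
    using finite_alt_group by (rule pair_graph_power_graph)
  assume firefly: "firefly_type_graph (power_graph (alt_group n))"
  have "\<not> n \<le> 3"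
    using firefly_type_graph_card_ge[OF graph firefly] card_alt_group_le_3[of n]
    by (auto simp: power_graph_def)
  moreover have "\<not> 5 \<le> n"
  proof
    assume "5 \<le> n"
    then obtain s where s: "s \<in> carrier (alt_group n)" "ord s = 5"
      by (rule ord_eq_5_in_alt_group)
    have "card (generate (alt_group n) {s}) \<le> 3"
      using clique_power_graph_generate[OF s(1)] s(2)
      by (intro firefly_type_graph_clique_card_le[OF graph firefly]) simp
    then show False
      using generate_pow_card[OF s(1)] s(2) by simp
  qed
  ultimately show "n = 4"
    by simp
next
  assume "n = 4"
  then show "firefly_type_graph (power_graph (alt_group n))"
    using group.firefly_type_power_graph_if_ord[OF alt_group_is_group finite_alt_group]
      ord_image_alt_group_4 by simp
qed

end
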